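(* Let $H$ be a finite group. Then the product $G=H^{\aleph_0}$ has a faithful action on a locally finite rooted tree with countably many isometry types.
   Context: $H^{\aleph_0}$ is the Cartesian product of countably many copies of $H$, a profinite group with the product topology. For a locally finite rooted tree $T$, $Iso(T)$ is the profinite group of all isometries of $T$ fixing the root. A faithful action of a profinite group $G$ on $T$ is a continuous injective homomorphism $G\to Iso(T)$ (so $G$ is realized as a closed subgroup). The action has countably many isometry types if the image of $G$ meets only (at most) countably many conjugacy classes of $Iso(T)$. *)

theory Defs
  imports
    "HOL-Algebra.Bij"
    "HOL-Algebra.Group_Action"
    "HOL-Algebra.Product_Groups"
    "HOL-Analysis.Function_Topology"
    "HOL-Library.Countable_Set"
    "Graph_Theory.Digraph_Component"
    "Graph_Theory.Shortest_Path"
begin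

text \<open>
  A simple undirected graph, finite or infinite, is represented by a symmetric loop-free digraph
  whose arcs are ordered pairs of vertices (\<^locale>\<open>pair_bidirected_digraph\<close>).  In such a
  digraph every edge gives a directed cycle of length 2, so the library predicates
  \<^const>\<open>forest\<close> and \<^const>\<open>tree\<close> do not describe undirected trees; an undirected
  cycle is a directed cycle of length at least 3.
\<close>

locale rooted_tree = pair_bidirected_digraph T for T :: "'v pair_pre_digraph" +
  fixes r :: 'v
  assumes root_in_verts: "r \<in> pverts T"
    and connected_tree: "Digraph_Component.connected (with_proj T)"
    and acyclic_tree: "\<not> (\<exists>p. pre_digraph.cycle (with_proj T) p \<and> 3 \<le> length p)"

locale locally_finite_rooted_tree = rooted_tree T r for T :: "'v pair_pre_digraph" and r +
  assumes locally_finite: "v \<in> pverts T \<Longrightarrow> finite (out_arcs (with_proj T) v)"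

definition tree_dist :: "'v pair_pre_digraph \<Rightarrow> 'v \<Rightarrow> 'v \<Rightarrow> ereal" where
  "tree_dist T u v = wf_digraph.\<mu> (with_proj T) (\<lambda>_. 1) u v"

definition Iso :: "'v pair_pre_digraph \<Rightarrow> 'v \<Rightarrow> ('v \<Rightarrow> 'v) monoid" where
  "Iso T r = BijGroup (pverts T)
     \<lparr>carrier := {f \<in> Bij (pverts T).
        (\<forall>u\<in>pverts T. \<forall>v\<in>pverts T. tree_dist T (f u) (f v) = tree_dist T u v) \<and> f r = r}\<rparr>"

text \<open>
  The topology of pointwise convergence, for the discrete topology on the vertices.  For a locally
  finite tree this is the profinite topology, i.e. that of the inverse limit of the finite groups
  induced on the balls around the root: fixing a finite set of vertices and fixing a ball
  pointwise define the same neighbourhoods of the identity.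
\<close>

definition Iso_topology :: "'v pair_pre_digraph \<Rightarrow> 'v \<Rightarrow> ('v \<Rightarrow> 'v) topology" where
  "Iso_topology T r = subtopology
     (product_topology (\<lambda>_. discrete_topology (pverts T)) (pverts T)) (carrier (Iso T r))"

text \<open>A topological group is given by a group \<open>G\<close> together with a topology \<open>X\<close> on its carrier.\<close>

definition faithful_tree_action ::
  "('g, 'm) monoid_scheme \<Rightarrow> 'g topology \<Rightarrow> 'v pair_pre_digraph \<Rightarrow> 'v \<Rightarrow> ('g \<Rightarrow> 'v \<Rightarrow> 'v) \<Rightarrow> bool" where
  "faithful_tree_action G X T r \<phi> \<longleftrightarrow>
     \<phi> \<in> hom G (Iso T r) \<and> inj_on \<phi> (carrier G) \<and> continuous_map X (Iso_topology T r) \<phi>"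

definition conjugacy_classes :: "('g, 'm) monoid_scheme \<Rightarrow> 'g set set" where
  "conjugacy_classes G =
     orbits G (carrier G) (\<lambda>g. \<lambda>h\<in>carrier G. g \<otimes>\<^bsub>G\<^esub> h \<otimes>\<^bsub>G\<^esub> inv\<^bsub>G\<^esub> g)"

definition countably_many_isometry_types ::
  "('g, 'm) monoid_scheme \<Rightarrow> 'v pair_pre_digraph \<Rightarrow> 'v \<Rightarrow> ('g \<Rightarrow> 'v \<Rightarrow> 'v) \<Rightarrow> bool" where
  "countably_many_isometry_types G T r \<phi> \<longleftrightarrow>
     countable {C \<in> conjugacy_classes (Iso T r). C \<inter> \<phi> ` carrier G \<noteq> {}}"

definition countable_power :: "('g, 'm) monoid_scheme \<Rightarrow> (nat \<Rightarrow> 'g) monoid" where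
  "countable_power H = product_group UNIV (\<lambda>_. H)"

definition countable_power_topology :: "('g, 'm) monoid_scheme \<Rightarrow> (nat \<Rightarrow> 'g) topology" where
  "countable_power_topology H = product_topology (\<lambda>_. discrete_topology (carrier H)) UNIV"

end

theory Submission
  imports
    Defs
    "HOL-Algebra.Multiplicative_Group"
    "HOL-Library.Nat_Bijection"
begin

text \<open>
  Let \<open>H\<^sup>\<nat>\<close> act on an infinite path with one leaf attached to its \<open>n\<close>-th vertex for every element of
  \<open>H\<^sup>n\<close>: the path is fixed, and the leaves at level \<open>n\<close> are permuted by left multiplication through
  the projection \<open>H\<^sup>\<nat> \<rightarrow> H\<^sup>n\<close>.  An element \<open>g\<close> with projections \<open>g\<^sub>n\<close> splits level \<open>n\<close> into cycles
  that all have length \<open>ord g\<^sub>n\<close>, and permutations of the different levels can be conjugated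
  independently of each other.  So the isometry type of \<open>g\<close> depends only on the sequence \<open>ord g\<^sub>n\<close>.
  This sequence is non-decreasing and bounded by the order of \<open>H\<close>, hence eventually constant, and
  there are only countably many such sequences.
\<close>

section \<open>Rooted trees given by a parent function\<close>

text \<open>Both orientations of each edge are arcs, as \<open>pair_bidirected_digraph\<close>
  demands. The root is excluded as a child, so that the value of \<open>p\<close> at
  \<open>r\<close> is a mere default and adds no arc.\<close>

definition parent_tree :: "'v set \<Rightarrow> 'v \<Rightarrow> ('v \<Rightarrow> 'v) \<Rightarrow> 'v pair_pre_digraph" where
  "parent_tree V r p =
     \<lparr>pverts = V, parcs = {(u, v). (u \<in> V - {r} \<and> v = p u) \<or> (v \<in> V - {r} \<and> u = p v)}\<rparr>"

lemma pverts_parent_tree [simp]: "pverts (parent_tree V r p) = V"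
  and parcs_parent_tree: "(u, v) \<in> parcs (parent_tree V r p) \<longleftrightarrow>
    (u \<in> V - {r} \<and> v = p u) \<or> (v \<in> V - {r} \<and> u = p v)"
  by (auto simp: parent_tree_def)

section \<open>Closed walks, and images of walks under vertex maps\<close>

lemma pcas_nth_Suc:
  "pcas u p v \<Longrightarrow> Suc i < length p \<Longrightarrow> fst (p ! Suc i) = snd (p ! i)"
proof (induction p arbitrary: u i)
  case (Cons e es)
  then show ?case
    by (cases i; cases es) auto
qed simp

lemma pcas_last: "pcas u p v \<Longrightarrow> p \<noteq> [] \<Longrightarrow> snd (last p) = v"
  by (induction p arbitrary: u) auto

text \<open>Indexing modulo the length treats the return to the start like any other step, so that
  every vertex of a cycle has a predecessor and a successor.\<close>

lemma pcas_closed_nth_mod: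
  assumes "pcas u p u" "i < length p"
  shows "fst (p ! (Suc i mod length p)) = snd (p ! i)"
proof (cases "Suc i < length p")
  case True
  then show ?thesis
    using assms pcas_nth_Suc by fastforce
next
  case False
  then have i: "Suc i = length p"
    using assms by simp
  then have "snd (p ! i) = u"
    using assms pcas_last[of u p u] by (metis diff_Suc_1 last_conv_nth length_0_conv not_less0)
  moreover have "fst (p ! 0) = u"
    using assms by (cases p) auto
  ultimately show ?thesis
    using i by simp
qed

text \<open>Turns the distinctness of vertices in the definition of a cycle into distinctness of the
  heads of its arcs.\<close>

lemma pawalk_verts_tl: "pcas u p v \<Longrightarrow> tl (pawalk_verts u p) = map snd p"
proof (induction p arbitrary: u)
  case (Cons e es)
  then show ?case
    by (cases es) auto
qed simp

lemma pcas_map: "pcas u p v \<Longrightarrow> pcas (f u) (map (map_prod f f) p) (f v)"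
  by (induction p arbitrary: u) auto

text \<open>A digraph homomorphism sends walks to walks of the same length, so the infimum over
  walks cannot grow.\<close>

lemma tree_dist_hom_le:
  assumes V: "f ` pverts T \<subseteq> pverts S"
    and E: "\<And>u v. (u, v) \<in> parcs T \<Longrightarrow> (f u, f v) \<in> parcs S"
    and wf: "pair_wf_digraph T" "pair_wf_digraph S"
  shows "tree_dist S (f u) (f v) \<le> tree_dist T u v"
proof -
  have T: "wf_digraph (with_proj T)" and S: "wf_digraph (with_proj S)"
    using wf by (simp_all add: wf_digraph_wp_iff)
  show ?thesis
    unfolding tree_dist_def wf_digraph.\<mu>_def[OF T] wf_digraph.\<mu>_def[OF S]
  proof (rule INF_mono)
    fix p
    assume p: "p \<in> {p. pre_digraph.awalk (with_proj T) u p v}"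
    have "pre_digraph.awalk (with_proj S) (f u) (map (map_prod f f) p) (f v)"
      using p V E pcas_map[of u p v f]
      by (auto simp: pre_digraph.awalk_def cas_with_proj_eq)
    then show "\<exists>q \<in> {q. pre_digraph.awalk (with_proj S) (f u) q (f v)}.
        ereal (wf_digraph.awalk_cost (\<lambda>_. 1) q) \<le> ereal (wf_digraph.awalk_cost (\<lambda>_. 1) p)"
      by (intro bexI[of _ "map (map_prod f f) p"]) (auto simp: wf_digraph.awalk_cost_def[OF T] wf_digraph.awalk_cost_def[OF S] comp_def)
  qed
qed

text \<open>The well-order serves twice: descending parents must end at the root, which gives
  connectedness, and a cycle has a largest vertex, which gives acyclicity.\<close>

locale parent_function =
  fixes V :: "'v::wellorder set" and r :: 'v and p :: "'v \<Rightarrow> 'v"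
  assumes root: "r \<in> V"
    and parent_in: "v \<in> V - {r} \<Longrightarrow> p v \<in> V"
    and parent_less: "v \<in> V - {r} \<Longrightarrow> p v < v"
begin

abbreviation "T \<equiv> parent_tree V r p"

lemma bidirected: "pair_bidirected_digraph T"
proof unfold_locales
  fix e
  assume "e \<in> parcs T"
  then show "fst e \<in> pverts T" "snd e \<in> pverts T" "fst e \<noteq> snd e"
    using parent_in parent_less by (cases e; fastforce simp: parcs_parent_tree)+
next
  show "symmetric T"
    by (auto simp: symmetric_def sym_def parcs_parent_tree)
qed

lemma wf: "pair_wf_digraph T"
  using bidirected by (simp add: pair_bidirected_digraph_def pair_loopfree_digraph_def)

lemma no_long_cycle:
  assumes "pre_digraph.cycle T c" "3 \<le> length c"
  shows False
proof -
  \<comment> \<open>Both neighbours of the largest vertex of the cycle would have to be its parent.\<close>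
  define n where "n = length c"
  obtain u where u: "pcas u c u" "distinct (tl (pawalk_verts u c))" "set c \<subseteq> parcs T"
    using assms unfolding pre_digraph.cycle_def pre_digraph.awalk_def
    by (auto simp: cas_with_proj_eq awalk_verts_with_proj_eq)
  have dist: "distinct (map snd c)"
    using u pawalk_verts_tl by metis
  have n: "3 \<le> n" "c \<noteq> []"
    using assms by (auto simp: n_def)
  have "Max (snd ` set c) \<in> snd ` set c"
    using n by simp
  then obtain m where m: "m < n" "snd (c ! m) = Max (snd ` set c)"
    by (auto simp: n_def in_set_conv_nth)
  have max: "snd (c ! i) \<le> snd (c ! m)" if "i < n" for i
    using that m by (simp add: n_def)
  \<comment> \<open>These index the arcs after and before arc \<open>m\<close> around the cycle.
    Adding \<open>n\<close> before subtracting \<open>1\<close> gives the right predecessor also for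
    \<open>m = 0\<close>.\<close>
  define j k where "j = Suc m mod n" and "k = (m + n - 1) mod n"
  have jk: "j < n" "k < n"
    using n by (simp_all add: j_def k_def)
  have "Suc k mod n = m"
    using m n by (simp add: k_def mod_Suc_eq)
  then have x: "fst (c ! m) = snd (c ! k)"
    using pcas_closed_nth_mod[OF u(1), of k] jk by (simp add: n_def)
  have y: "fst (c ! j) = snd (c ! m)"
    using pcas_closed_nth_mod[OF u(1), of m] m by (simp add: j_def n_def)
  have "(snd (c ! k), snd (c ! m)) \<in> parcs T" "(snd (c ! m), snd (c ! j)) \<in> parcs T"
    using u(3) m jk x y by (metis n_def nth_mem prod.collapse subset_iff)+
  moreover have "snd (c ! k) \<le> snd (c ! m)" "snd (c ! j) \<le> snd (c ! m)"
    using max jk by auto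
  ultimately have "snd (c ! k) = snd (c ! j)"
    using parent_less by (auto simp: parcs_parent_tree dest: leD)
  then have "k = j"
    using dist jk by (simp add: distinct_conv_nth n_def) blast
  \<comment> \<open>Predecessor and successor modulo \<open>n\<close> coincide only for
    \<open>n\<close> at most 2; this is where \<open>3 \<le> length c\<close> enters.\<close>
  moreover have "k \<noteq> j"
  proof (cases m)
    case 0
    then show ?thesis
      using n by (simp add: j_def k_def)
  next
    case (Suc l)
    then have "k = l"
      using m by (simp add: k_def)
    then show ?thesis
      using n m Suc by (cases "Suc m = n") (auto simp: j_def)
  qed
  ultimately show False
    by simp
qed

lemma reachable_root: "v \<in> V \<Longrightarrow> v \<rightarrow>\<^sup>*\<^bsub>T\<^esub> r"
proof (induction v rule: less_induct)
  case (less v)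
  interpret pair_wf_digraph T
    by (rule wf)
  show ?case
  proof (cases "v = r")
    case False
    then have "(v, p v) \<in> parcs T" "p v \<rightarrow>\<^sup>*\<^bsub>T\<^esub> r"
      using less parent_in parent_less by (auto simp: parcs_parent_tree)
    then show ?thesis
      by (meson adj_reachable_trans)
  qed (use root in auto)
qed

lemma rooted_tree: "rooted_tree T r"
proof -
  interpret pair_bidirected_digraph T
    by (rule bidirected)
  \<comment> \<open>Connectedness is strong connectedness of the symmetric closure, which here is
    the digraph itself.\<close>
  have "mk_symmetric T = T"
    by (auto simp: mk_symmetric_def parent_tree_def)
  moreover have "u \<rightarrow>\<^sup>*\<^bsub>T\<^esub> v" if "u \<in> V" "v \<in> V" for u v
    using that reachable_root by (meson reachable_trans symmetric_reachable')
  ultimately have "connected T"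
    using root by (auto simp: connected_def strongly_connected_def)
  then show ?thesis
    using root no_long_cycle by unfold_locales auto
qed

lemma locally_finite_rooted_tree:
  assumes "\<And>u. u \<in> V \<Longrightarrow> finite {v \<in> V - {r}. p v = u}"
  shows "locally_finite_rooted_tree T r"
proof -
  interpret rooted_tree T r
    by (rule rooted_tree)
  show ?thesis
  proof unfold_locales
    fix u
    assume "u \<in> pverts T"
    then have "finite (Pair u ` (insert (p u) {v \<in> V - {r}. p v = u}))"
      using assms by simp
    then show "finite (out_arcs T u)"
      by (rule rev_finite_subset) (auto simp: out_arcs_def parcs_parent_tree)
  qed
qed

lemma tree_dist_le:
  assumes "f \<in> V \<rightarrow> V" "f ` (V - {r}) \<subseteq> V - {r}" "\<And>v. v \<in> V - {r} \<Longrightarrow> p (f v) = f (p v)"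
  shows "tree_dist T (f u) (f v) \<le> tree_dist T u v"
  using assms by (intro tree_dist_hom_le wf) (auto simp: parcs_parent_tree)

text \<open>Both \<open>f\<close> and its inverse preserve parents, hence adjacency, so neither
  increases distances; together they preserve them.\<close>

lemma in_Iso:
  assumes f: "f \<in> Bij V" "f r = r" "\<And>v. v \<in> V - {r} \<Longrightarrow> p (f v) = f (p v)"
  shows "f \<in> carrier (Iso T r)"
proof -
  have bij: "bij_betw f V V"
    using f by (simp add: Bij_def)
  define g where "g = inv_into V f"
  have inv: "\<And>v. v \<in> V \<Longrightarrow> g (f v) = v" "\<And>v. v \<in> V \<Longrightarrow> f (g v) = v"
    using bij by (simp_all add: g_def bij_betw_inv_into_left bij_betw_inv_into_right)
  have fV: "\<And>v. v \<in> V \<Longrightarrow> f v \<in> V" and gV: "\<And>v. v \<in> V \<Longrightarrow> g v \<in> V"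
    using bij bij_betw_inv_into[OF bij] by (auto simp: g_def bij_betw_apply)
  have gr: "g r = r"
    using inv f root by metis
  have fr: "f v \<noteq> r" "g v \<noteq> r" if "v \<in> V - {r}" for v
    using that inv f gr by (metis DiffE singletonI)+
  have "p (g v) = g (p v)" if v: "v \<in> V - {r}" for v
  proof -
    have "g v \<in> V - {r}"
      using v gV fr by auto
    then have "f (p (g v)) = p v" "p (g v) \<in> V"
      using f(3)[of "g v"] inv v parent_in by auto
    then show ?thesis
      using inv by metis
  qed
  then have "tree_dist T (g u) (g v) \<le> tree_dist T u v" for u v
    using gV fr by (intro tree_dist_le) auto
  moreover have "tree_dist T (f u) (f v) \<le> tree_dist T u v" for u v
    using fV fr f by (intro tree_dist_le) auto
  ultimately have "\<forall>u\<in>V. \<forall>v\<in>V. tree_dist T (f u) (f v) = tree_dist T u v"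
    using inv by (metis order_antisym)
  then show ?thesis
    using f by (simp add: Iso_def)
qed

end

section \<open>The isometries fixing the root as a subgroup of all vertex bijections\<close>

lemma group_Iso:
  assumes "r \<in> pverts T"
  shows "group (Iso T r)"
proof -
  interpret B: group "BijGroup (pverts T)"
    by (rule group_BijGroup)
  let ?I = "{f \<in> Bij (pverts T).
    (\<forall>u\<in>pverts T. \<forall>v\<in>pverts T. tree_dist T (f u) (f v) = tree_dist T u v) \<and> f r = r}"
  have "subgroup ?I (BijGroup (pverts T))"
  proof (rule B.subgroupI)
    show "?I \<subseteq> carrier (BijGroup (pverts T))"
      by (auto simp: BijGroup_def)
    show "?I \<noteq> {}"
      using id_Bij[of "pverts T"] assms by fastforce
  next
    fix f
    assume f: "f \<in> ?I"
    then have bij: "bij_betw f (pverts T) (pverts T)"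
      by (simp add: Bij_def)
    let ?g = "inv_into (pverts T) f"
    have "tree_dist T (?g u) (?g v) = tree_dist T u v" if "u \<in> pverts T" "v \<in> pverts T" for u v
      using that f bij_betw_inv_into_right[OF bij] Bij_inv_into_mem[of f "pverts T"]
      by (smt (verit) mem_Collect_eq)
    moreover have "?g r = r"
      using f bij_betw_inv_into_left[OF bij assms] by simp
    ultimately show "inv\<^bsub>BijGroup (pverts T)\<^esub> f \<in> ?I"
      using f assms by (simp add: inv_BijGroup restrict_inv_into_Bij)
  next
    fix f g
    assume "f \<in> ?I" "g \<in> ?I"
    then show "f \<otimes>\<^bsub>BijGroup (pverts T)\<^esub> g \<in> ?I"
      using assms Bij_imp_funcset[of g "pverts T"]
      by (auto simp: BijGroup_def compose_Bij compose_eq Pi_iff)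
  qed
  then show ?thesis
    unfolding Iso_def by (rule B.subgroup_imp_group)
qed

lemma mult_Iso:
  "f \<in> carrier (Iso T r) \<Longrightarrow> g \<in> carrier (Iso T r) \<Longrightarrow> f \<otimes>\<^bsub>Iso T r\<^esub> g = compose (pverts T) f g"
  by (simp add: Iso_def BijGroup_def)

section \<open>Left multiplication by elements of equal order\<close>

text \<open>The cycles of left multiplication by \<open>a\<close> are the right cosets of the
  subgroup generated by \<open>a\<close>. Equal orders give, by Lagrange, equally many cosets for
  \<open>a\<close> and \<open>b\<close>, so the cycles can be paired and matched starting from
  chosen representatives.\<close>

lemma (in group) left_mult_conjugate_if_ord_eq:
  assumes fin: "finite (carrier G)"
    and a: "a \<in> carrier G" and b: "b \<in> carrier G" and ord: "ord a = ord b"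
  shows "\<exists>s. bij_betw s (carrier G) (carrier G) \<and> (\<forall>x\<in>carrier G. s (a \<otimes> x) = b \<otimes> s x)"
proof -
  let ?A = "generate G {a}" and ?B = "generate G {b}"
  have A: "subgroup ?A G" and B: "subgroup ?B G"
    using a b by (simp_all add: generate_is_subgroup)
  have AC: "?A \<subseteq> carrier G" and BC: "?B \<subseteq> carrier G"
    using A B by (simp_all add: subgroup.subset)
  have pow: "a [^] i = a [^] j \<longleftrightarrow> b [^] i = b [^] j" for i j :: int
    using a b ord by (simp add: int_pow_eq)
  \<comment> \<open>On \<open>?A\<close> this sends each power of \<open>a\<close> to the same power
    of \<open>b\<close>; by \<open>pow\<close> the result does not depend on the exponent
    chosen.\<close>
  define \<theta> where "\<theta> x = b [^] (SOME i::int. x = a [^] i)" for x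
  have \<theta>: "\<theta> (a [^] i) = b [^] i" for i :: int
    unfolding \<theta>_def using pow someI[of "\<lambda>j. a [^] i = a [^] j" i] by metis
  have Ai: "\<exists>i::int. x = a [^] i" if "x \<in> ?A" for x
    using that generate_pow[OF a] by auto
  have \<theta>B: "\<theta> x \<in> ?B" if "x \<in> ?A" for x
    using Ai[OF that] generate_pow[OF b] \<theta> by auto
  have \<theta>_inj: "x = y" if "x \<in> ?A" "y \<in> ?A" "\<theta> x = \<theta> y" for x y
    using Ai that pow \<theta> by metis
  have \<theta>_mult: "\<theta> (a \<otimes> x) = b \<otimes> \<theta> x" if "x \<in> ?A" for x
  proof -
    obtain i :: int where i: "x = a [^] i"
      using Ai \<open>x \<in> ?A\<close> by blast
    have "a \<otimes> x = a [^] (1 + i)" "b \<otimes> b [^] i = b [^] (1 + i)"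
      using a b by (simp_all add: i int_pow_mult)
    then show ?thesis
      using i \<theta> by metis
  qed
  have "0 < card ?A" "card ?A = card ?B"
    using generate_pow_card[OF a] generate_pow_card[OF b] ord ord_ge_1[OF fin a] by simp_all
  then have "card (rcosets ?A) = card (rcosets ?B)"
    using lagrange[OF A] lagrange[OF B] by (metis mult_cancel2 neq0_conv)
  moreover have "finite (rcosets ?A)" "finite (rcosets ?B)"
    using fin by (simp_all add: RCOSETS_def)
  ultimately obtain \<beta> where \<beta>: "bij_betw \<beta> (rcosets ?A) (rcosets ?B)"
    using finite_same_card_bij by blast
  define t where "t C = (SOME x. x \<in> C)" for C :: "'a set"
  have t: "t C \<in> carrier G \<and> C = K #> t C" if C: "C \<in> rcosets K" and K: "subgroup K G" for C K
  proof -
    obtain x where x: "x \<in> carrier G" "C = K #> x"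
      using C unfolding RCOSETS_def by blast
    then have "x \<in> C"
      using K rcos_self by blast
    then have "t C \<in> C"
      unfolding t_def by (rule someI)
    then have "t C \<in> K #> x"
      using x(2) by (rule subst[rotated])
    then have "K #> x = K #> t C" "t C \<in> carrier G"
      using K x(1) repr_independence r_coset_subset_G subgroup.subset by blast+
    then show ?thesis
      using x(2) by blast
  qed
  \<comment> \<open>Each \<open>x\<close> is a power of \<open>a\<close> times the representative of
    its coset. The map replaces the power by that of \<open>b\<close> and the representative by that
    of the paired coset.\<close>
  define s where "s x = \<theta> (x \<otimes> inv (t (?A #> x))) \<otimes> t (\<beta> (?A #> x))" for x
  have coset: "?A #> x \<in> rcosets ?A" "\<beta> (?A #> x) \<in> rcosets ?B" if "x \<in> carrier G" for x
    using that AC \<beta> by (auto simp: rcosetsI bij_betw_apply)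
  have tA: "t (?A #> x) \<in> carrier G" "t (\<beta> (?A #> x)) \<in> carrier G" "?A #> x = ?A #> t (?A #> x)"
    "x \<otimes> inv (t (?A #> x)) \<in> ?A" if x: "x \<in> carrier G" for x
  proof -
    show *: "t (?A #> x) \<in> carrier G" "t (\<beta> (?A #> x)) \<in> carrier G" "?A #> x = ?A #> t (?A #> x)"
      using coset[OF x] t A B by blast+
    then have "x \<in> ?A #> t (?A #> x)"
      using x A rcos_self by metis
    then obtain y where "y \<in> ?A" "x = y \<otimes> t (?A #> x)"
      by (auto simp: r_coset_def)
    then show "x \<otimes> inv (t (?A #> x)) \<in> ?A"
      using * AC by (metis inv_solve_right' subsetD x)
  qed
  have sC: "s x \<in> carrier G" and s_coset: "?B #> s x = \<beta> (?A #> x)" if x: "x \<in> carrier G" for x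
  proof -
    have *: "\<theta> (x \<otimes> inv (t (?A #> x))) \<in> ?B"
      using tA[OF x] \<theta>B by blast
    then show "s x \<in> carrier G"
      unfolding s_def using tA[OF x] BC by blast
    have "?B #> s x = (?B #> \<theta> (x \<otimes> inv (t (?A #> x)))) #> t (\<beta> (?A #> x))"
      unfolding s_def using tA[OF x] BC * by (simp add: coset_mult_assoc subsetD)
    also have "?B #> \<theta> (x \<otimes> inv (t (?A #> x))) = ?B"
      using * B BC by (simp add: coset_join2 subsetD)
    also have "?B #> t (\<beta> (?A #> x)) = \<beta> (?A #> x)"
      using t coset[OF x] B by metis
    finally show "?B #> s x = \<beta> (?A #> x)" .
  qed
  have "inj_on s (carrier G)"
  proof (rule inj_onI)
    fix x y
    assume x: "x \<in> carrier G" and y: "y \<in> carrier G" and eq: "s x = s y"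
    then have "\<beta> (?A #> x) = \<beta> (?A #> y)"
      using s_coset by metis
    \<comment> \<open>Equal images lie in one coset of \<open>?B\<close>, so the arguments lie in
      one coset of \<open>?A\<close> and share both representatives.\<close>
    then have C: "?A #> x = ?A #> y"
      using coset x y \<beta> by (meson bij_betw_inv_into_left bij_betw_imp_inj_on inj_onD)
    have "\<theta> (x \<otimes> inv (t (?A #> x))) = \<theta> (y \<otimes> inv (t (?A #> x)))"
      using eq tA[OF x] tA[OF y] \<theta>B BC unfolding s_def C by (metis right_cancel subsetD)
    then have "x \<otimes> inv (t (?A #> x)) = y \<otimes> inv (t (?A #> x))"
      using \<theta>_inj tA[OF x] tA[OF y] C by metis
    then show "x = y"
      using x y tA[OF x] by simp
  qed
  moreover have "s ` carrier G \<subseteq> carrier G"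
    using sC by blast
  ultimately have "bij_betw s (carrier G) (carrier G)"
    using fin by (simp add: bij_betw_def endo_inj_surj)
  moreover have "s (a \<otimes> x) = b \<otimes> s x" if x: "x \<in> carrier G" for x
  proof -
    \<comment> \<open>Left multiplication by \<open>a\<close> stays within a coset, so the
      representatives used for \<open>a \<otimes> x\<close> and for \<open>x\<close> agree.\<close>
    have "a \<in> ?A"
      by (simp add: generate.incl)
    then have "?A #> (a \<otimes> x) = ?A #> x"
      using a x A AC by (metis coset_join2 coset_mult_assoc)
    then show ?thesis
      unfolding s_def using \<theta>_mult[of "x \<otimes> inv (t (?A #> x))"] \<theta>B tA[OF x] a b x BC
      by (simp add: m_assoc subsetD)
  qed
  ultimately show ?thesis
    by blast
qed

section \<open>Countability of the bounded non-decreasing sequences\<close>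

lemma countable_bounded_mono: "countable {f :: nat \<Rightarrow> nat. mono f \<and> (\<forall>n. f n \<le> N)}"
proof (rule countable_subset)
  \<comment> \<open>Decodes a finite list of initial values and an eventual constant. A bounded
    monotone sequence is such a pair, since it stays constant once it attains its maximum.\<close>
  let ?e = "\<lambda>(xs, c) n. if n < length xs then xs ! n else c"
  show "countable (range (?e :: nat list \<times> nat \<Rightarrow> nat \<Rightarrow> nat))"
    by simp
  show "{f :: nat \<Rightarrow> nat. mono f \<and> (\<forall>n. f n \<le> N)} \<subseteq> range ?e"
  proof
    fix f :: "nat \<Rightarrow> nat"
    assume f: "f \<in> {f. mono f \<and> (\<forall>n. f n \<le> N)}"
    then have "mono f" and le: "range f \<subseteq> {..N}"
      by (simp_all add: image_subset_iff)
    have fin: "finite (range f)"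
      using le finite_atMost by (rule finite_subset)
    then have "Max (range f) \<in> range f"
      by (intro Max_in) simp_all
    then obtain m where m: "f m = Max (range f)"
      by (metis imageE)
    have eventually: "f n = f m" if "m \<le> n" for n
    proof (rule order_antisym)
      show "f n \<le> f m"
        using fin m by simp
      show "f m \<le> f n"
        using \<open>mono f\<close> that by (simp add: monoD)
    qed
    have "f n = ?e (map f [0..<m], f m) n" for n
      using eventually[of n] by (cases "n < m") simp_all
    then have "f = ?e (map f [0..<m], f m)" ..
    then show "f \<in> range ?e"
      by blast
  qed
qed

section \<open>Infinite paths with leaves attached\<close>

text \<open>Vertices are coded as naturals, with second component \<open>0\<close> reserved for the
  path. The pairing function grows in each argument, so the usual order on naturals puts parents
  before children.\<close>

definition node :: "nat \<Rightarrow> nat" where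
  "node n = prod_encode (n, 0)"

definition leaf :: "nat \<Rightarrow> nat \<Rightarrow> nat" where
  "leaf n i = prod_encode (n, Suc i)"

text \<open>
  The vertices \<^term>\<open>node n\<close> form an infinite path starting at the root \<^term>\<open>node 0\<close>; the
  leaves \<^term>\<open>leaf n i\<close>, with \<^term>\<open>i\<close> in a given set \<open>X n\<close>, are attached to \<^term>\<open>node n\<close>.
\<close>

lemma node_leaf_simps [simp]:
  "node m = node n \<longleftrightarrow> m = n" "leaf m i = leaf n j \<longleftrightarrow> m = n \<and> i = j"
  "node m \<noteq> leaf n i" "leaf n i \<noteq> node m"
  by (auto simp: node_def leaf_def)

lemma node_less_node_Suc: "node n < node (Suc n)"
  by (simp add: node_def prod_encode_def)

lemma node_less_leaf: "node n < leaf n i"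
  by (induction i) (simp_all add: node_def leaf_def prod_encode_def)

definition cat_verts :: "(nat \<Rightarrow> nat set) \<Rightarrow> nat set" where
  "cat_verts X = range node \<union> (\<Union>n. leaf n ` X n)"

lemma node_in_cat_verts [simp]: "node n \<in> cat_verts X"
  and leaf_in_cat_verts [simp]: "leaf n i \<in> cat_verts X \<longleftrightarrow> i \<in> X n"
  by (auto simp: cat_verts_def)

lemma cat_verts_cases [consumes 1, case_names node leaf]:
  assumes "v \<in> cat_verts X"
  obtains n where "v = node n" | n i where "i \<in> X n" "v = leaf n i"
  using assms by (auto simp: cat_verts_def)

text \<open>Truncated subtraction makes \<open>node 0\<close> its own parent, the default value that
  \<open>parent_tree\<close> ignores.\<close>

definition cat_parent :: "nat \<Rightarrow> nat" where
  "cat_parent v = (case prod_decode v of (n, 0) \<Rightarrow> node (n - 1) | (n, Suc i) \<Rightarrow> node n)"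

lemma cat_parent_simps [simp]:
  "cat_parent (node n) = node (n - 1)" "cat_parent (leaf n i) = node n"
  by (simp_all add: cat_parent_def node_def leaf_def)

definition caterpillar :: "(nat \<Rightarrow> nat set) \<Rightarrow> nat pair_pre_digraph" where
  "caterpillar X = parent_tree (cat_verts X) (node 0) cat_parent"

lemma pverts_caterpillar [simp]: "pverts (caterpillar X) = cat_verts X"
  by (simp add: caterpillar_def)

interpretation cat: parent_function "cat_verts X" "node 0" cat_parent for X
proof unfold_locales
  fix v
  assume v: "v \<in> cat_verts X - {node 0}"
  then have "v \<in> cat_verts X" ..
  then show "cat_parent v \<in> cat_verts X"
    by (cases rule: cat_verts_cases) auto
  from \<open>v \<in> cat_verts X\<close> show "cat_parent v < v"
  proof (cases rule: cat_verts_cases)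
    case (node n)
    then show ?thesis
      using v node_less_node_Suc by (cases n) auto
  qed (simp add: node_less_leaf)
qed simp

lemma locally_finite_caterpillar:
  assumes "\<And>n. finite (X n)"
  shows "locally_finite_rooted_tree (caterpillar X) (node 0)"
  unfolding caterpillar_def
proof (rule cat.locally_finite_rooted_tree)
  fix u
  assume "u \<in> cat_verts X"
  then show "finite {v \<in> cat_verts X - {node 0}. cat_parent v = u}"
  proof (cases rule: cat_verts_cases)
    case (node n)
    have "{v \<in> cat_verts X - {node 0}. cat_parent v = u} \<subseteq> insert (node (Suc n)) (leaf n ` X n)"
      using node by (auto simp: cat_verts_def)
    then show ?thesis
      using assms by (rule finite_subset[OF _ finite.insertI[OF finite_imageI]])
  next
    case (leaf n i)
    then have "{v \<in> cat_verts X - {node 0}. cat_parent v = u} = {}"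
      by (auto simp: cat_verts_def)
    then show ?thesis
      by (metis finite.emptyI)
  qed
qed

text \<open>Restricting to the vertex set makes the map extensional, as membership in
  \<open>Bij\<close> requires.\<close>

definition leaf_map :: "(nat \<Rightarrow> nat set) \<Rightarrow> (nat \<Rightarrow> nat \<Rightarrow> nat) \<Rightarrow> nat \<Rightarrow> nat" where
  "leaf_map X \<sigma> = (\<lambda>v\<in>cat_verts X. case prod_decode v of (n, 0) \<Rightarrow> v | (n, Suc i) \<Rightarrow> leaf n (\<sigma> n i))"

lemma leaf_map_node [simp]: "leaf_map X \<sigma> (node n) = node n"
  using node_in_cat_verts[of n X] by (simp add: leaf_map_def node_def)

lemma leaf_map_leaf [simp]: "i \<in> X n \<Longrightarrow> leaf_map X \<sigma> (leaf n i) = leaf n (\<sigma> n i)"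
  using leaf_in_cat_verts[of n i X] by (simp add: leaf_map_def leaf_def)

lemma leaf_map_extensional: "leaf_map X \<sigma> \<in> extensional (cat_verts X)"
  by (simp add: leaf_map_def)

lemma leaf_map_eq_iff: "leaf_map X \<sigma> = leaf_map X \<tau> \<longleftrightarrow> (\<forall>n. \<forall>i\<in>X n. \<sigma> n i = \<tau> n i)"
proof
  assume eq: "leaf_map X \<sigma> = leaf_map X \<tau>"
  show "\<forall>n. \<forall>i\<in>X n. \<sigma> n i = \<tau> n i"
  proof (intro allI ballI)
    fix n i
    assume "i \<in> X n"
    then show "\<sigma> n i = \<tau> n i"
      using fun_cong[OF eq, of "leaf n i"] by simp
  qed
next
  assume eq: "\<forall>n. \<forall>i\<in>X n. \<sigma> n i = \<tau> n i"
  have "leaf_map X \<sigma> v = leaf_map X \<tau> v" if "v \<in> cat_verts X" for v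
    using that by (cases rule: cat_verts_cases) (use eq in auto)
  then show "leaf_map X \<sigma> = leaf_map X \<tau>"
    by (rule extensionalityI[OF leaf_map_extensional leaf_map_extensional])
qed

lemma compose_leaf_map:
  assumes "\<And>n i. i \<in> X n \<Longrightarrow> \<tau> n i \<in> X n"
  shows "compose (cat_verts X) (leaf_map X \<sigma>) (leaf_map X \<tau>) = leaf_map X (\<lambda>n i. \<sigma> n (\<tau> n i))"
proof (rule extensionalityI[OF compose_extensional leaf_map_extensional])
  fix v
  assume "v \<in> cat_verts X"
  then show "compose (cat_verts X) (leaf_map X \<sigma>) (leaf_map X \<tau>) v = leaf_map X (\<lambda>n i. \<sigma> n (\<tau> n i)) v"
    by (cases rule: cat_verts_cases) (use assms in \<open>auto simp: compose_eq\<close>)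
qed

text \<open>Leaves are permuted only among those at the same path vertex, so parents are preserved;
  the levelwise inverses give the inverse map.\<close>

lemma leaf_map_in_Iso:
  assumes \<sigma>: "\<And>n. bij_betw (\<sigma> n) (X n) (X n)"
  shows "leaf_map X \<sigma> \<in> carrier (Iso (caterpillar X) (node 0))"
  unfolding caterpillar_def
proof (rule cat.in_Iso)
  define \<tau> where "\<tau> n = inv_into (X n) (\<sigma> n)" for n
  have mem: "\<sigma> n i \<in> X n" "\<tau> n i \<in> X n" if "i \<in> X n" for n i
    unfolding \<tau>_def
    using that bij_betw_apply[OF \<sigma>] bij_betw_apply[OF bij_betw_inv_into[OF \<sigma>]] by simp_all
  have inv: "\<tau> n (\<sigma> n i) = i" "\<sigma> n (\<tau> n i) = i" if "i \<in> X n" for n i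
    unfolding \<tau>_def
    using bij_betw_inv_into_left[OF \<sigma> that] bij_betw_inv_into_right[OF \<sigma> that] by simp_all
  have maps: "leaf_map X \<rho> \<in> cat_verts X \<rightarrow> cat_verts X" if "\<And>n i. i \<in> X n \<Longrightarrow> \<rho> n i \<in> X n" for \<rho>
    using that by (auto simp: Pi_iff elim!: cat_verts_cases)
  have "bij_betw (leaf_map X \<sigma>) (cat_verts X) (cat_verts X)"
    using maps[of \<sigma>, OF mem(1)] maps[of \<tau>, OF mem(2)]
  proof (rule bij_betwI)
    fix v
    assume "v \<in> cat_verts X"
    then show "leaf_map X \<tau> (leaf_map X \<sigma> v) = v" "leaf_map X \<sigma> (leaf_map X \<tau> v) = v"
      by (cases rule: cat_verts_cases; simp add: mem inv)+
  qed
  then show "leaf_map X \<sigma> \<in> Bij (cat_verts X)"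
    by (simp add: Bij_def leaf_map_extensional)
  fix v
  assume "v \<in> cat_verts X - {node 0}"
  then have "v \<in> cat_verts X" ..
  then show "cat_parent (leaf_map X \<sigma> v) = leaf_map X \<sigma> (cat_parent v)"
    by (cases rule: cat_verts_cases) auto
qed simp

text \<open>Conjugating permutations chosen separately on each level assemble into one isometry. The
  two elements are then conjugate, and classes with a common element are equal.\<close>

lemma conjugacy_classes_leaf_map:
  fixes X
  defines "I \<equiv> Iso (caterpillar X) (node 0)"
  assumes \<sigma>: "\<And>n. bij_betw (\<sigma> n) (X n) (X n)" and \<tau>: "\<And>n. bij_betw (\<tau> n) (X n) (X n)"
    and conj: "\<And>n. \<exists>s. bij_betw s (X n) (X n) \<and> (\<forall>i\<in>X n. s (\<sigma> n i) = \<tau> n (s i))"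
    and C: "C \<in> conjugacy_classes I" "leaf_map X \<sigma> \<in> C"
    and D: "D \<in> conjugacy_classes I" "leaf_map X \<tau> \<in> D"
  shows "C = D"
proof -
  interpret I: group I
    unfolding I_def by (rule group_Iso) simp
  interpret conj: group_action I "carrier I" "\<lambda>g. \<lambda>h\<in>carrier I. g \<otimes>\<^bsub>I\<^esub> h \<otimes>\<^bsub>I\<^esub> inv\<^bsub>I\<^esub> g"
    by (rule I.action_by_conjugation)
  obtain s where s: "\<And>n. bij_betw (s n) (X n) (X n)" "\<And>n i. i \<in> X n \<Longrightarrow> s n (\<sigma> n i) = \<tau> n (s n i)"
    using conj by metis
  have mem: "leaf_map X \<sigma> \<in> carrier I" "leaf_map X \<tau> \<in> carrier I" "leaf_map X s \<in> carrier I"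
    using leaf_map_in_Iso \<sigma> \<tau> s unfolding I_def by blast+
  have "leaf_map X s \<otimes>\<^bsub>I\<^esub> leaf_map X \<sigma> = leaf_map X \<tau> \<otimes>\<^bsub>I\<^esub> leaf_map X s"
    using mem bij_betw_apply[OF \<sigma>] bij_betw_apply[OF s(1)] s(2)
    by (simp add: I_def mult_Iso compose_leaf_map leaf_map_eq_iff)
  then have \<tau>_conj: "leaf_map X s \<otimes>\<^bsub>I\<^esub> leaf_map X \<sigma> \<otimes>\<^bsub>I\<^esub> inv\<^bsub>I\<^esub> leaf_map X s = leaf_map X \<tau>"
    using mem by (simp add: I.inv_solve_right' I.m_assoc)
  obtain x where x: "x \<in> carrier I" "C = orbit I (\<lambda>g. \<lambda>h\<in>carrier I. g \<otimes>\<^bsub>I\<^esub> h \<otimes>\<^bsub>I\<^esub> inv\<^bsub>I\<^esub> g) x"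
    using C by (auto simp: conjugacy_classes_def orbits_def)
  have "leaf_map X \<tau> \<in> orbit I (\<lambda>g. \<lambda>h\<in>carrier I. g \<otimes>\<^bsub>I\<^esub> h \<otimes>\<^bsub>I\<^esub> inv\<^bsub>I\<^esub> g) (leaf_map X \<sigma>)"
    using mem \<tau>_conj by (force simp: orbit_def)
  then have "leaf_map X \<tau> \<in> C"
    using conj.orbit_trans x mem C by blast
  then show "C = D"
    using conj.disjoint_union[of C D] C D unfolding conjugacy_classes_def by blast
qed

section \<open>The action of the countable power\<close>

lemma nat_pow_product_group:
  assumes "\<And>i. i \<in> I \<Longrightarrow> group (G i)" "x \<in> carrier (product_group I G)"
  shows "x [^]\<^bsub>product_group I G\<^esub> (k::nat) = (\<lambda>i\<in>I. x i [^]\<^bsub>G i\<^esub> k)"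
  by (induction k) (auto simp: nat_pow_def fun_eq_iff)

locale finite_group = group G for G (structure) +
  assumes finite_carrier: "finite (carrier G)"
begin

abbreviation K :: "nat \<Rightarrow> (nat \<Rightarrow> 'a) monoid" where
  "K n \<equiv> product_group {..<n} (\<lambda>_. G)"

lemma group_K: "group (K n)"
  using group_axioms by simp

lemma finite_K: "finite (carrier (K n))"
  using finite_carrier by (simp add: finite_PiE)

text \<open>The leaves at level \<open>n\<close> are the natural-number codes of the elements of \<^term>\<open>K n\<close>.\<close>

definition level :: "nat \<Rightarrow> nat set" where
  "level n = to_nat_on (carrier (K n)) ` carrier (K n)"

text \<open>Left translation by the image of \<open>g\<close> in \<open>K n\<close>, transported
  along the numbering of \<open>K n\<close>.\<close>

definition level_act :: "(nat \<Rightarrow> 'a) \<Rightarrow> nat \<Rightarrow> nat \<Rightarrow> nat" where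
  "level_act g n i =
     to_nat_on (carrier (K n)) (restrict g {..<n} \<otimes>\<^bsub>K n\<^esub> from_nat_into (carrier (K n)) i)"

definition power_act :: "(nat \<Rightarrow> 'a) \<Rightarrow> nat \<Rightarrow> nat" where
  "power_act g = leaf_map level (level_act g)"

lemma finite_level: "finite (level n)"
  unfolding level_def using finite_K by blast

lemma bij_betw_level: "bij_betw (to_nat_on (carrier (K n))) (carrier (K n)) (level n)"
  unfolding level_def using countable_finite[OF finite_K]
  by (simp add: bij_betw_def inj_on_to_nat_on del: carrier_product_group)

lemma from_nat_into_level: "i \<in> level n \<Longrightarrow> from_nat_into (carrier (K n)) i \<in> carrier (K n)"
  and to_nat_on_level: "i \<in> level n \<Longrightarrow> to_nat_on (carrier (K n)) (from_nat_into (carrier (K n)) i) = i"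
  unfolding level_def using countable_finite[OF finite_K]
  by (auto simp del: carrier_product_group)

lemma level_act_to_nat_on:
  assumes "x \<in> carrier (K n)"
  shows "level_act g n (to_nat_on (carrier (K n)) x) =
    to_nat_on (carrier (K n)) (restrict g {..<n} \<otimes>\<^bsub>K n\<^esub> x)"
  using assms countable_finite[OF finite_K]
  by (simp add: level_act_def del: carrier_product_group mult_product_group)

lemma restrict_power:
  "g \<in> carrier (countable_power G) \<Longrightarrow> restrict g {..<n} \<in> carrier (K n)"
  by (auto simp: countable_power_def)

lemma restrict_power_mult:
  "restrict (g \<otimes>\<^bsub>countable_power G\<^esub> h) {..<n} = restrict g {..<n} \<otimes>\<^bsub>K n\<^esub> restrict h {..<n}"
  by (auto simp: countable_power_def fun_eq_iff)

text \<open>Cancellation in \<open>K n\<close> gives injectivity, and finiteness of the level then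
  gives surjectivity.\<close>

lemma bij_betw_level_act:
  assumes g: "g \<in> carrier (countable_power G)"
  shows "bij_betw (level_act g n) (level n) (level n)"
proof -
  interpret K: group "K n"
    by (rule group_K)
  let ?e = "to_nat_on (carrier (K n))"
  have e: "inj_on ?e (carrier (K n))"
    using bij_betw_level by (rule bij_betw_imp_inj_on)
  have "inj_on (level_act g n) (level n)"
  proof (rule inj_onI)
    fix i j
    assume i: "i \<in> level n" and j: "j \<in> level n" and eq: "level_act g n i = level_act g n j"
    obtain x y where xy: "x \<in> carrier (K n)" "y \<in> carrier (K n)" "i = ?e x" "j = ?e y"
      using i j unfolding level_def by blast
    then have "restrict g {..<n} \<otimes>\<^bsub>K n\<^esub> x = restrict g {..<n} \<otimes>\<^bsub>K n\<^esub> y"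
      using eq e restrict_power[OF g, of n] K.m_closed
      by (metis inj_onD level_act_to_nat_on)
    then show "i = j"
      using xy restrict_power[OF g, of n] by (simp del: carrier_product_group mult_product_group)
  qed
  moreover have "level_act g n ` level n \<subseteq> level n"
  proof clarify
    fix i
    assume "i \<in> level n"
    then show "level_act g n i \<in> level n"
      unfolding level_act_def using from_nat_into_level restrict_power[OF g, of n] K.m_closed
      by (metis bij_betw_apply[OF bij_betw_level])
  qed
  ultimately show ?thesis
    using finite_level by (simp add: bij_betw_def endo_inj_surj)
qed

lemma level_act_mult:
  assumes "g \<in> carrier (countable_power G)" "h \<in> carrier (countable_power G)" "i \<in> level n"
  shows "level_act (g \<otimes>\<^bsub>countable_power G\<^esub> h) n i = level_act g n (level_act h n i)"
proof -
  interpret K: group "K n"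
    by (rule group_K)
  define x where "x = from_nat_into (carrier (K n)) i"
  have x: "x \<in> carrier (K n)" "i = to_nat_on (carrier (K n)) x"
    using assms from_nat_into_level to_nat_on_level by (simp_all add: x_def)
  show ?thesis
    using x(1) restrict_power[OF assms(1), of n] restrict_power[OF assms(2), of n]
    unfolding x(2)
    by (simp add: level_act_to_nat_on restrict_power_mult K.m_assoc
        del: carrier_product_group mult_product_group)
qed

text \<open>The image of a fixed vertex depends on finitely many coordinates of \<open>g\<close>, so
  every preimage is a union of open cylinders.\<close>

lemma continuous_power_act_apply:
  assumes v: "v \<in> cat_verts level"
  shows "continuous_map (countable_power_topology G) (discrete_topology (cat_verts level))
           (\<lambda>g. power_act g v)"
proof -
  have carrier: "topspace (countable_power_topology G) = carrier (countable_power G)"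
    by (simp add: countable_power_topology_def countable_power_def)
  obtain n where n: "\<And>g h. restrict g {..<n} = restrict h {..<n} \<Longrightarrow> power_act g v = power_act h v"
    using v
  proof (cases rule: cat_verts_cases)
    case (node m)
    then show thesis
      by (intro that) (simp add: power_act_def)
  next
    case (leaf m i)
    then show thesis
      by (intro that[of m]) (simp add: power_act_def level_act_def del: mult_product_group)
  qed
  have "power_act g v \<in> cat_verts level" if "g \<in> carrier (countable_power G)" for g
    using v
  proof (cases rule: cat_verts_cases)
    case (leaf m i)
    then show ?thesis
      using bij_betw_apply[OF bij_betw_level_act[OF that]] by (simp add: power_act_def)
  qed (simp add: power_act_def)
  moreover have "openin (countable_power_topology G)
      {g \<in> topspace (countable_power_topology G). power_act g v \<in> U}" for U
  proof (subst openin_subopen, intro ballI)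
    fix g
    assume g: "g \<in> {g \<in> topspace (countable_power_topology G). power_act g v \<in> U}"
    \<comment> \<open>The cylinder of all sequences that agree with \<open>g\<close> in the first
      \<open>n\<close> coordinates.\<close>
    define N where "N = (\<Pi>\<^sub>E i\<in>UNIV. if i < n then {g i} else carrier G)"
    have gi: "g i \<in> carrier G" for i
      using g by (auto simp: carrier countable_power_def)
    have "{i. (if i < n then {g i} else carrier G) \<noteq> carrier G} \<subseteq> {..<n}"
      by auto
    then have "finite {i. (if i < n then {g i} else carrier G) \<noteq> carrier G}"
      by (rule finite_subset) simp
    then have "openin (countable_power_topology G) N"
      using gi unfolding countable_power_topology_def N_def openin_PiE_gen by auto
    moreover have "g \<in> N"
      using gi by (auto simp: N_def)
    moreover have "h \<in> {g \<in> topspace (countable_power_topology G). power_act g v \<in> U}"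
      if h: "h \<in> N" for h
    proof -
      have *: "h i \<in> (if i < n then {g i} else carrier G)" for i
        using h unfolding N_def by (rule PiE_mem) simp
      have "h i = g i" if "i < n" for i
        using *[of i] that by simp
      then have "power_act h v = power_act g v"
        by (intro n) auto
      moreover have "h i \<in> carrier G" for i
        using *[of i] gi by (auto split: if_splits)
      ultimately show ?thesis
        using g by (simp add: carrier countable_power_def PiE_iff)
    qed
    ultimately show "\<exists>W. openin (countable_power_topology G) W \<and> g \<in> W \<and>
        W \<subseteq> {g \<in> topspace (countable_power_topology G). power_act g v \<in> U}"
      by blast
  qed
  ultimately show ?thesis
    by (auto simp: continuous_map_def carrier)
qed

lemma power_act_in_Iso:
  "g \<in> carrier (countable_power G) \<Longrightarrow> power_act g \<in> carrier (Iso (caterpillar level) (node 0))"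
  unfolding power_act_def by (intro leaf_map_in_Iso bij_betw_level_act)

text \<open>The leaf coded by the identity is moved to the leaf coded by the truncation of
  \<open>g\<close>, which reveals its coordinates. Coordinate \<open>k\<close> first appears at
  level \<open>Suc k\<close>.\<close>

lemma inj_on_power_act: "inj_on power_act (carrier (countable_power G))"
proof (rule inj_onI)
  fix g h
  assume g: "g \<in> carrier (countable_power G)" and h: "h \<in> carrier (countable_power G)"
    and eq: "power_act g = power_act h"
  have "g k = h k" for k
  proof -
    interpret K: group "K (Suc k)"
      by (rule group_K)
    let ?e = "to_nat_on (carrier (K (Suc k)))"
    have "?e \<one>\<^bsub>K (Suc k)\<^esub> \<in> level (Suc k)"
      using K.one_closed unfolding level_def by blast
    then have "level_act g (Suc k) (?e \<one>\<^bsub>K (Suc k)\<^esub>) = level_act h (Suc k) (?e \<one>\<^bsub>K (Suc k)\<^esub>)"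
      using eq unfolding power_act_def leaf_map_eq_iff by blast
    then have "?e (restrict g {..<Suc k}) = ?e (restrict h {..<Suc k})"
      using level_act_to_nat_on[OF K.one_closed] restrict_power[OF g] restrict_power[OF h] K.r_one
      by metis
    then have "restrict g {..<Suc k} = restrict h {..<Suc k}"
      using bij_betw_imp_inj_on[OF bij_betw_level] restrict_power[OF g] restrict_power[OF h]
      by (metis inj_onD)
    then show ?thesis
      by (metis lessThan_iff lessI restrict_apply')
  qed
  then show "g = h" ..
qed

lemma faithful_power_act:
  "faithful_tree_action (countable_power G) (countable_power_topology G)
     (caterpillar level) (node 0) power_act"
  unfolding faithful_tree_action_def
proof (intro conjI inj_on_power_act)
  show "power_act \<in> hom (countable_power G) (Iso (caterpillar level) (node 0))"
  proof (rule homI)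
    fix g h
    assume g: "g \<in> carrier (countable_power G)" and h: "h \<in> carrier (countable_power G)"
    have "power_act (g \<otimes>\<^bsub>countable_power G\<^esub> h) =
        leaf_map level (\<lambda>n i. level_act g n (level_act h n i))"
      using g h by (simp add: power_act_def leaf_map_eq_iff level_act_mult)
    also have "\<dots> = compose (cat_verts level) (power_act g) (power_act h)"
      unfolding power_act_def
      using bij_betw_apply[OF bij_betw_level_act[OF h]] by (simp add: compose_leaf_map)
    finally show "power_act (g \<otimes>\<^bsub>countable_power G\<^esub> h) =
        power_act g \<otimes>\<^bsub>Iso (caterpillar level) (node 0)\<^esub> power_act h"
      using g h by (simp add: mult_Iso power_act_in_Iso)
  qed (rule power_act_in_Iso)
  have "topspace (countable_power_topology G) = carrier (countable_power G)"
    by (simp add: countable_power_topology_def countable_power_def)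
  \<comment> \<open>The target carries the topology of pointwise convergence, so continuity is
    checked one vertex at a time.\<close>
  then show "continuous_map (countable_power_topology G)
      (Iso_topology (caterpillar level) (node 0)) power_act"
    unfolding Iso_topology_def continuous_map_in_subtopology continuous_map_componentwise
    using continuous_power_act_apply power_act_in_Iso
    by (auto simp: power_act_def leaf_map_extensional image_subset_iff)
qed

text \<open>The common length of the cycles of \<open>g\<close> on level \<open>n\<close>.\<close>

definition ord_profile :: "(nat \<Rightarrow> 'a) \<Rightarrow> nat \<Rightarrow> nat" where
  "ord_profile g n = group.ord (K n) (restrict g {..<n})"

text \<open>A power in a product is trivial exactly when it is trivial in every coordinate.
  Monotonicity and boundedness of the profile are both read off from this divisibility.\<close>

lemma ord_profile_dvd_iff:
  assumes "g \<in> carrier (countable_power G)"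
  shows "ord_profile g n dvd k \<longleftrightarrow> (\<forall>i<n. g i [^] k = \<one>)"
proof -
  interpret K: group "K n"
    by (rule group_K)
  have "ord_profile g n dvd k \<longleftrightarrow> restrict g {..<n} [^]\<^bsub>K n\<^esub> k = \<one>\<^bsub>K n\<^esub>"
    using restrict_power[OF assms] by (metis K.pow_eq_id ord_profile_def)
  also have "\<dots> \<longleftrightarrow> (\<forall>i<n. g i [^] k = \<one>)"
    using nat_pow_product_group[of "{..<n}" "\<lambda>_. G", OF _ restrict_power[OF assms]] group_axioms
    by (auto simp: fun_eq_iff)
  finally show ?thesis .
qed

lemma countable_ord_profile: "countable (ord_profile ` carrier (countable_power G))"
proof (rule countable_subset)
  show "countable {f :: nat \<Rightarrow> nat. mono f \<and> (\<forall>n. f n \<le> order G)}"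
    by (rule countable_bounded_mono)
  show "ord_profile ` carrier (countable_power G) \<subseteq> {f. mono f \<and> (\<forall>n. f n \<le> order G)}"
  proof clarify
    fix g
    assume g: "g \<in> carrier (countable_power G)"
    then have gi: "g i \<in> carrier G" for i
      by (auto simp: countable_power_def)
    have order: "0 < order G"
      using finite_carrier by (simp add: order_gt_0_iff_finite)
    have dvd: "ord_profile g n dvd order G" for n
      using gi pow_order_eq_1 by (simp add: ord_profile_dvd_iff[OF g])
    \<comment> \<open>The exponent \<open>ord_profile g n\<close> kills all coordinates below
      \<open>n\<close>, in particular those below \<open>m\<close>.\<close>
    have "ord_profile g m dvd ord_profile g n" if "m \<le> n" for m n
      using that ord_profile_dvd_iff[OF g, of n "ord_profile g n"]
      by (simp add: ord_profile_dvd_iff[OF g])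
    \<comment> \<open>Positivity is what turns divisibility into the order on naturals.\<close>
    moreover have "0 < ord_profile g n" for n
      using dvd[of n] order by (metis dvd_0_left neq0_conv)
    ultimately have "mono (ord_profile g)"
      by (intro monoI dvd_imp_le)
    then show "mono (ord_profile g) \<and> (\<forall>n. ord_profile g n \<le> order G)"
      using dvd order by (simp add: dvd_imp_le)
  qed
qed

lemma level_act_conjugate:
  assumes g: "g \<in> carrier (countable_power G)" and h: "h \<in> carrier (countable_power G)"
    and eq: "ord_profile g n = ord_profile h n"
  shows "\<exists>s. bij_betw s (level n) (level n) \<and>
    (\<forall>i\<in>level n. s (level_act g n i) = level_act h n (s i))"
proof -
  interpret K: group "K n"
    by (rule group_K)
  let ?e = "to_nat_on (carrier (K n))" and ?d = "from_nat_into (carrier (K n))"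
  have gK: "restrict g {..<n} \<in> carrier (K n)" and hK: "restrict h {..<n} \<in> carrier (K n)"
    using g h restrict_power by blast+
  obtain s where s: "bij_betw s (carrier (K n)) (carrier (K n))"
    "\<And>x. x \<in> carrier (K n) \<Longrightarrow>
      s (restrict g {..<n} \<otimes>\<^bsub>K n\<^esub> x) = restrict h {..<n} \<otimes>\<^bsub>K n\<^esub> s x"
    using K.left_mult_conjugate_if_ord_eq[OF finite_K gK hK] eq unfolding ord_profile_def by blast
  have de: "?d (?e x) = x" if "x \<in> carrier (K n)" for x
    using that countable_finite[OF finite_K] by (rule from_nat_into_to_nat_on[rotated])
  have d: "bij_betw ?d (level n) (carrier (K n))"
    using to_nat_on_level from_nat_into_level de bij_betw_apply[OF bij_betw_level]
    by (intro bij_betwI[where g = ?e]) auto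
  \<comment> \<open>The conjugating permutation of \<open>K n\<close> is carried over to the codes:
    decode, apply \<open>s\<close>, encode.\<close>
  have "bij_betw (?e \<circ> (s \<circ> ?d)) (level n) (level n)"
    using d s(1) bij_betw_level by (intro bij_betw_trans)
  moreover have "(?e \<circ> (s \<circ> ?d)) (level_act g n i) = level_act h n ((?e \<circ> (s \<circ> ?d)) i)"
    if i: "i \<in> level n" for i
  proof -
    have "?d i \<in> carrier (K n)" "s (?d i) \<in> carrier (K n)"
      using bij_betw_apply[OF d i] bij_betw_apply[OF s(1)] by blast+
    then show ?thesis
      using gK s(2) de by (simp add: level_act_to_nat_on level_act_def[of g]
          del: carrier_product_group mult_product_group)
  qed
  ultimately show ?thesis
    by blast
qed

text \<open>Choosing one group element for each class that meets the image, the class is determined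
  by the order profile of that element, and only countably many profiles occur.\<close>

lemma countably_many_isometry_types_power_act:
  "countably_many_isometry_types (countable_power G) (caterpillar level) (node 0) power_act"
proof -
  let ?P = "carrier (countable_power G)"
  let ?\<C> = "{C \<in> conjugacy_classes (Iso (caterpillar level) (node 0)). C \<inter> power_act ` ?P \<noteq> {}}"
  have "\<forall>C\<in>?\<C>. \<exists>g. g \<in> ?P \<and> power_act g \<in> C"
    by blast
  then have "\<exists>\<gamma>. \<forall>C\<in>?\<C>. \<gamma> C \<in> ?P \<and> power_act (\<gamma> C) \<in> C"
    by (rule bchoice)
  then obtain \<gamma> where \<gamma>: "\<And>C. C \<in> ?\<C> \<Longrightarrow> \<gamma> C \<in> ?P \<and> power_act (\<gamma> C) \<in> C"
    by (elim exE) (rule that, erule bspec)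
  have "inj_on (\<lambda>C. ord_profile (\<gamma> C)) ?\<C>"
  proof (rule inj_onI)
    fix C D
    assume C: "C \<in> ?\<C>" and D: "D \<in> ?\<C>" and eq: "ord_profile (\<gamma> C) = ord_profile (\<gamma> D)"
    show "C = D"
    proof (rule conjugacy_classes_leaf_map)
      show "bij_betw (level_act (\<gamma> C) n) (level n) (level n)"
        "bij_betw (level_act (\<gamma> D) n) (level n) (level n)" for n
        using \<gamma> C D by (simp_all add: bij_betw_level_act)
      show "\<exists>s. bij_betw s (level n) (level n) \<and>
          (\<forall>i\<in>level n. s (level_act (\<gamma> C) n i) = level_act (\<gamma> D) n (s i))" for n
        using \<gamma>[OF C] \<gamma>[OF D] eq by (intro level_act_conjugate) auto
      show "leaf_map level (level_act (\<gamma> C)) \<in> C" "leaf_map level (level_act (\<gamma> D)) \<in> D"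
        using \<gamma>[OF C] \<gamma>[OF D] by (simp_all add: power_act_def)
    qed (use C D in auto)
  qed
  moreover have "countable ((\<lambda>C. ord_profile (\<gamma> C)) ` ?\<C>)"
    using \<gamma> by (intro countable_subset[OF _ countable_ord_profile]) auto
  ultimately show ?thesis
    unfolding countably_many_isometry_types_def by (rule countable_image_inj_on[rotated])
qed

end

theorem proposition2p5:
  fixes H :: "('a, 'm) monoid_scheme"
  assumes "group H" and "finite (carrier H)"
  shows "\<exists>(T :: nat pair_pre_digraph) r \<phi>.
           locally_finite_rooted_tree T r \<and>
           faithful_tree_action (countable_power H) (countable_power_topology H) T r \<phi> \<and>
           countably_many_isometry_types (countable_power H) T r \<phi>"
proof -
  interpret finite_group H
    using assms by (simp add: finite_group_def finite_group_axioms_def)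
  show ?thesis
    \<comment> \<open>Unification with the listed facts supplies the witnesses
      \<open>caterpillar level\<close>, \<open>node 0\<close> and \<open>power_act\<close>.\<close>
    by (intro exI conjI) (rule locally_finite_caterpillar finite_level faithful_power_act
        countably_many_isometry_types_power_act)+
qed

end
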